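(* (1) (i) Let $(\boldsymbol{\gamma},\boldsymbol{\nu}_1,\boldsymbol{\nu}_2):U\to H^3\times\Delta_5$ be a one-parameter family of hyperbolic framed curves with respect to $u$, with curvature functions $m_1,n_1,a_1,b_1,M_1,N_1,A_1,B_1,P_1,Q_1$. Then $(\boldsymbol{\gamma},\boldsymbol{\nu}_1,\boldsymbol{\nu}_2)$ is a hyperbolic generalized framed surface with $\alpha(u,v)=-m_1(u,v)Q_1(u,v)$ and $\beta(u,v)=m_1(u,v)P_1(u,v)$. (ii) Let $(\boldsymbol{\gamma},\boldsymbol{\nu}_1,\boldsymbol{\nu}_2):U\to H^3\times\Delta_5$ be a one-parameter family of hyperbolic framed curves with respect to $v$, with curvature functions $m_2,n_2,a_2,b_2,M_2,N_2,A_2,B_2,P_2,Q_2$. Then $(\boldsymbol{\gamma},\boldsymbol{\nu}_1,\boldsymbol{\nu}_2)$ is a hyperbolic generalized framed surface with $\alpha(u,v)=m_2(u,v)Q_2(u,v)$ and $\beta(u,v)=-m_2(u,v)P_2(u,v)$. (2) Let $(\boldsymbol{x},\boldsymbol{\nu}_1,\boldsymbol{\nu}_2):U\to H^3\times\Delta_5$ be a hyperbolic generalized framed surface with basic invariants $a_i,b_i,c_i,e_i,f_i,g_i$, $i=1,2$. (i) If $a_1(u,v)=b_1(u,v)=0$ for all $(u,v)\in U$, then $(\boldsymbol{x},\boldsymbol{\nu}_1,\boldsymbol{\nu}_2)$ and $(\boldsymbol{x},\boldsymbol{\nu}_2,\boldsymbol{\nu}_1)$ are one-parameter families of hyperbolic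 framed curves with respect to $u$. (ii) If $a_2(u,v)=b_2(u,v)=0$ for all $(u,v)\in U$, then $(\boldsymbol{x},\boldsymbol{\nu}_1,\boldsymbol{\nu}_2)$ and $(\boldsymbol{x},\boldsymbol{\nu}_2,\boldsymbol{\nu}_1)$ are one-parameter families of hyperbolic framed curves with respect to $v$.
   Context: $\mathbb{R}^4_1$ is $\mathbb{R}^4$ with the pseudo inner product $\langle \boldsymbol{x},\boldsymbol{y}\rangle=-x_1y_1+x_2y_2+x_3y_3+x_4y_4$. The pseudo vector product $\boldsymbol{x}\wedge\boldsymbol{y}\wedge\boldsymbol{z}$ of three vectors of $\mathbb{R}^4_1$ is the unique vector with $\langle \boldsymbol{w},\boldsymbol{x}\wedge\boldsymbol{y}\wedge\boldsymbol{z}\rangle=\det(\boldsymbol{w},\boldsymbol{x},\boldsymbol{y},\boldsymbol{z})$ for all $\boldsymbol{w}\in\mathbb{R}^4_1$. $H^3=\{\boldsymbol{x}\in\mathbb{R}^4_1: \langle\boldsymbol{x},\boldsymbol{x}\rangle=-1,\ x_1>0\}$, $S^3_1=\{\boldsymbol{x}\in\mathbb{R}^4_1:\langle\boldsymbol{x},\boldsymbol{x}\rangle=1\}$, $\Delta_5=\{(\boldsymbol{\nu}_1,\boldsymbol{\nu}_2)\in S^3_1\times S^3_1:\langle\boldsymbol{\nu}_1,\boldsymbol{\nu}_2\rangle=0\}$. $U$ is a simply connected open subset of $\mathbb{R}^2$ with coordinates $(u,v)$; subscripts $u,v$ denote partial derivatives; all maps are $C^\infty$. One-parameter family of hyperbolic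 framed curves with respect to $u$ (respectively $v$): a smooth map $(\boldsymbol{\gamma},\boldsymbol{\nu}_1,\boldsymbol{\nu}_2):U\to H^3\times\Delta_5$ with $\langle\boldsymbol{\gamma},\boldsymbol{\nu}_i\rangle=\langle\boldsymbol{\gamma}_u,\boldsymbol{\nu}_i\rangle=0$ (respectively $\langle\boldsymbol{\gamma},\boldsymbol{\nu}_i\rangle=\langle\boldsymbol{\gamma}_v,\boldsymbol{\nu}_i\rangle=0$) on $U$ for $i=1,2$. Put $\boldsymbol{\mu}=\boldsymbol{\gamma}\wedge\boldsymbol{\nu}_1\wedge\boldsymbol{\nu}_2$. In the case with respect to $u$ the curvature is the tuple of smooth functions given by $\boldsymbol{\gamma}_u=m_1\boldsymbol{\mu}$, $\boldsymbol{\nu}_{1u}=n_1\boldsymbol{\nu}_2+a_1\boldsymbol{\mu}$, $\boldsymbol{\nu}_{2u}=-n_1\boldsymbol{\nu}_1+b_1\boldsymbol{\mu}$, $\boldsymbol{\mu}_u=m_1\boldsymbol{\gamma}-a_1\boldsymbol{\nu}_1-b_1\boldsymbol{\nu}_2$, $\boldsymbol{\gamma}_v=P_1\boldsymbol{\nu}_1+Q_1\boldsymbol{\nu}_2+M_1\boldsymbol{\mu}$, $\boldsymbol{\nu}_{1v}=P_1\boldsymbol{\gamma}+N_1\boldsymbol{\nu}_2+A_1\boldsymbol{\mu}$, $\boldsymbol{\nu}_{2v}=Q_1\boldsymbol{\gamma}-N_1\boldsymbol{\nu}_1+B_1\boldsymbol{\mu}$, $\boldsymbol{\mu}_v=M_1\boldsymbol{\gamma}-A_1\boldsymbol{\nu}_1-B_1\boldsymbol{\nu}_2$.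 In the case with respect to $v$ the curvature is given by the same formulas with the roles of $u$ and $v$ exchanged and index $1$ on the curvature functions replaced by $2$ (so $\boldsymbol{\gamma}_v=m_2\boldsymbol{\mu}$, $\boldsymbol{\gamma}_u=P_2\boldsymbol{\nu}_1+Q_2\boldsymbol{\nu}_2+M_2\boldsymbol{\mu}$, etc.). Hyperbolic generalized framed surface: a smooth map $(\boldsymbol{x},\boldsymbol{\nu}_1,\boldsymbol{\nu}_2):U\to H^3\times\Delta_5$ with $\langle\boldsymbol{x},\boldsymbol{\nu}_1\rangle=\langle\boldsymbol{x},\boldsymbol{\nu}_2\rangle=0$ on $U$ for which there are smooth functions $\alpha,\beta:U\to\mathbb{R}$ with $\boldsymbol{x}\wedge\boldsymbol{x}_u\wedge\boldsymbol{x}_v=\alpha\boldsymbol{\nu}_1+\beta\boldsymbol{\nu}_2$ on $U$; "with $\alpha=\dots,\beta=\dots$" refers to these functions. With $\boldsymbol{\nu}_3=\boldsymbol{x}\wedge\boldsymbol{\nu}_1\wedge\boldsymbol{\nu}_2$, its basic invariants are the smooth functions given by $\boldsymbol{x}_u=a_1\boldsymbol{\nu}_1+b_1\boldsymbol{\nu}_2+c_1\boldsymbol{\nu}_3$, $\boldsymbol{\nu}_{1u}=a_1\boldsymbol{x}+e_1\boldsymbol{\nu}_2+f_1\boldsymbol{\nu}_3$, $\boldsymbol{\nu}_{2u}=b_1\boldsymbol{x}-e_1\boldsymbol{\nu}_1+g_1\boldsymbol{\nu}_3$, $\boldsymbol{\nu}_{3u}=c_1\boldsymbol{x}-f_1\boldsymbol{\nu}_1-g_1\boldsymbol{\nu}_2$,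 and the same formulas with $u$ replaced by $v$ and index $1$ by $2$. *)

theory Defs
  imports "HOL-Analysis.Analysis"
begin

type_synonym plane = "real \<times> real"
type_synonym vec4 = "real ^ 4"

definition pd_u :: "(plane \<Rightarrow> 'a::real_normed_vector) \<Rightarrow> plane \<Rightarrow> 'a" where
  "pd_u f p = vector_derivative (\<lambda>t. f (t, snd p)) (at (fst p))"

definition pd_v :: "(plane \<Rightarrow> 'a::real_normed_vector) \<Rightarrow> plane \<Rightarrow> 'a" where
  "pd_v f p = vector_derivative (\<lambda>t. f (fst p, t)) (at (snd p))"

text \<open>\<open>Ck_on k U f\<close> and \<open>smooth_on U f\<close> are meant for open \<open>U\<close>.  Since \<open>pd_u\<close> and \<open>pd_v\<close> are total,
  differentiability is demanded explicitly at each stage, and only the values on \<open>U\<close> matter.\<close>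

primrec Ck_on :: "nat \<Rightarrow> plane set \<Rightarrow> (plane \<Rightarrow> 'a::real_normed_vector) \<Rightarrow> bool" where
  "Ck_on 0 U f \<longleftrightarrow> continuous_on U f"
| "Ck_on (Suc k) U f \<longleftrightarrow> f differentiable_on U \<and> Ck_on k U (pd_u f) \<and> Ck_on k U (pd_v f)"

definition smooth_on :: "plane set \<Rightarrow> (plane \<Rightarrow> 'a::real_normed_vector) \<Rightarrow> bool" where
  "smooth_on U f \<longleftrightarrow> (\<forall>k. Ck_on k U f)"

definition lorentz :: "vec4 \<Rightarrow> vec4 \<Rightarrow> real" where
  "lorentz x y = - (x $ 1 * y $ 1) + x $ 2 * y $ 2 + x $ 3 * y $ 3 + x $ 4 * y $ 4"

text \<open>The matrix has rows \<open>w, x, y, z\<close>; \<open>det_transpose\<close> makes the choice of rows immaterial.\<close>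

definition wedge :: "vec4 \<Rightarrow> vec4 \<Rightarrow> vec4 \<Rightarrow> vec4" where
  "wedge x y z = (THE n. \<forall>w. lorentz w n = det (vector [w, x, y, z] :: real ^ 4 ^ 4))"

lemma lorentz_representation:
  fixes f :: "vec4 \<Rightarrow> real"
  assumes "linear f"
  shows "\<exists>!n. \<forall>w. lorentz w n = f w"
proof -
  have f: "f w = w $ 1 * f (axis 1 1) + w $ 2 * f (axis 2 1) + w $ 3 * f (axis 3 1) + w $ 4 * f (axis 4 1)" for w
  proof -
    have "w = (\<Sum>i\<in>UNIV. w $ i *s axis i 1)"
      by (simp add: basis_expansion)
    then have "f w = f (\<Sum>i\<in>UNIV. w $ i *\<^sub>R axis i 1)"
      by (simp add: scalar_mult_eq_scaleR)
    also have "\<dots> = (\<Sum>i\<in>UNIV. w $ i * f (axis i 1))"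
      using assms by (simp add: linear_sum linear_scale)
    finally show ?thesis by (simp add: sum_4)
  qed
  show ?thesis
  proof (rule ex1I)
    show "\<forall>w. lorentz w (vector [- f (axis 1 1), f (axis 2 1), f (axis 3 1), f (axis 4 1)]) = f w"
      by (subst f) (simp add: lorentz_def vector_def)
  next
    fix n assume n: "\<forall>w. lorentz w n = f w"
    have "n $ 1 = - f (axis 1 1)" "n $ 2 = f (axis 2 1)" "n $ 3 = f (axis 3 1)" "n $ 4 = f (axis 4 1)"
      using n[rule_format, of "axis 1 1"] n[rule_format, of "axis 2 1"]
        n[rule_format, of "axis 3 1"] n[rule_format, of "axis 4 1"]
      by (simp_all add: lorentz_def axis_def)
    then show "n = vector [- f (axis 1 1), f (axis 2 1), f (axis 3 1), f (axis 4 1)]"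
      by (simp add: vec_eq_iff forall_4 vector_def)
  qed
qed

lemma wedge_exists_unique:
  "\<exists>!n. \<forall>w. lorentz w n = det (vector [w, x, y, z] :: real ^ 4 ^ 4)"
proof (rule lorentz_representation)
  define c where "c = (\<lambda>i::4. if i = 2 then x else if i = 3 then y else z)"
  have row: "(vector [w, x, y, z] :: real ^ 4 ^ 4) = (\<chi> i. if i = 1 then w else c i)" for w
    by (simp add: vec_eq_iff forall_4 vector_def c_def)
  show "linear (\<lambda>w. det (vector [w, x, y, z] :: real ^ 4 ^ 4))"
    unfolding row
  proof (rule linearI)
    fix v w :: vec4 and r :: real
    show "det (\<chi> i. if i = 1 then v + w else c i)
        = det (\<chi> i. if i = 1 then v else c i) + det (\<chi> i. if i = 1 then w else c i)"
      using det_row_add[of 1 "\<lambda>_. v" "\<lambda>_. w" c] by simp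
    show "det (\<chi> i. if i = 1 then r *\<^sub>R v else c i) = r *\<^sub>R det (\<chi> i. if i = 1 then v else c i)"
      using det_row_mul[of 1 r "\<lambda>_. v" c] unfolding scalar_mult_eq_scaleR by simp
  qed
qed

definition H3 :: "vec4 set" where
  "H3 = {x. lorentz x x = - 1 \<and> x $ 1 > 0}"

definition S31 :: "vec4 set" where
  "S31 = {x. lorentz x x = 1}"

definition Delta5 :: "(vec4 \<times> vec4) set" where
  "Delta5 = {(n1, n2) \<in> S31 \<times> S31. lorentz n1 n2 = 0}"

definition smooth_map_H3_Delta5 ::
  "plane set \<Rightarrow> (plane \<Rightarrow> vec4) \<Rightarrow> (plane \<Rightarrow> vec4) \<Rightarrow> (plane \<Rightarrow> vec4) \<Rightarrow> bool" where
  "smooth_map_H3_Delta5 U x \<nu>1 \<nu>2 \<longleftrightarrow>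
     smooth_on U x \<and> smooth_on U \<nu>1 \<and> smooth_on U \<nu>2 \<and>
     (\<forall>p\<in>U. x p \<in> H3 \<and> (\<nu>1 p, \<nu>2 p) \<in> Delta5)"

text \<open>The operator \<open>D\<close> below is \<open>pd_u\<close> for families with respect to \<open>u\<close>, and \<open>pd_v\<close> for families with
  respect to \<open>v\<close>; \<open>D'\<close> is the other one.\<close>

definition hyp_framed_curve_family ::
  "((plane \<Rightarrow> vec4) \<Rightarrow> plane \<Rightarrow> vec4) \<Rightarrow> plane set \<Rightarrow>
   (plane \<Rightarrow> vec4) \<Rightarrow> (plane \<Rightarrow> vec4) \<Rightarrow> (plane \<Rightarrow> vec4) \<Rightarrow> bool" where
  "hyp_framed_curve_family D U \<gamma> \<nu>1 \<nu>2 \<longleftrightarrow>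
     smooth_map_H3_Delta5 U \<gamma> \<nu>1 \<nu>2 \<and>
     (\<forall>p\<in>U. lorentz (\<gamma> p) (\<nu>1 p) = 0 \<and> lorentz (\<gamma> p) (\<nu>2 p) = 0 \<and>
            lorentz (D \<gamma> p) (\<nu>1 p) = 0 \<and> lorentz (D \<gamma> p) (\<nu>2 p) = 0)"

definition wedge_field ::
  "(plane \<Rightarrow> vec4) \<Rightarrow> (plane \<Rightarrow> vec4) \<Rightarrow> (plane \<Rightarrow> vec4) \<Rightarrow> plane \<Rightarrow> vec4" where
  "wedge_field x \<nu>1 \<nu>2 p = wedge (x p) (\<nu>1 p) (\<nu>2 p)"

definition family_curvature ::
  "((plane \<Rightarrow> vec4) \<Rightarrow> plane \<Rightarrow> vec4) \<Rightarrow> ((plane \<Rightarrow> vec4) \<Rightarrow> plane \<Rightarrow> vec4) \<Rightarrow> plane set \<Rightarrow>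
   (plane \<Rightarrow> vec4) \<Rightarrow> (plane \<Rightarrow> vec4) \<Rightarrow> (plane \<Rightarrow> vec4) \<Rightarrow>
   (plane \<Rightarrow> real) \<Rightarrow> (plane \<Rightarrow> real) \<Rightarrow> (plane \<Rightarrow> real) \<Rightarrow> (plane \<Rightarrow> real) \<Rightarrow>
   (plane \<Rightarrow> real) \<Rightarrow> (plane \<Rightarrow> real) \<Rightarrow> (plane \<Rightarrow> real) \<Rightarrow> (plane \<Rightarrow> real) \<Rightarrow>
   (plane \<Rightarrow> real) \<Rightarrow> (plane \<Rightarrow> real) \<Rightarrow> bool" where
  "family_curvature D D' U \<gamma> \<nu>1 \<nu>2 m n a b M N A B P Q \<longleftrightarrow>
     (\<forall>f\<in>{m, n, a, b, M, N, A, B, P, Q}. smooth_on U f) \<and>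
     (let \<mu> = wedge_field \<gamma> \<nu>1 \<nu>2 in
      \<forall>p\<in>U.
        D \<gamma> p = m p *\<^sub>R \<mu> p \<and>
        D \<nu>1 p = n p *\<^sub>R \<nu>2 p + a p *\<^sub>R \<mu> p \<and>
        D \<nu>2 p = - n p *\<^sub>R \<nu>1 p + b p *\<^sub>R \<mu> p \<and>
        D \<mu> p = m p *\<^sub>R \<gamma> p - a p *\<^sub>R \<nu>1 p - b p *\<^sub>R \<nu>2 p \<and>
        D' \<gamma> p = P p *\<^sub>R \<nu>1 p + Q p *\<^sub>R \<nu>2 p + M p *\<^sub>R \<mu> p \<and>
        D' \<nu>1 p = P p *\<^sub>R \<gamma> p + N p *\<^sub>R \<nu>2 p + A p *\<^sub>R \<mu> p \<and>
        D' \<nu>2 p = Q p *\<^sub>R \<gamma> p - N p *\<^sub>R \<nu>1 p + B p *\<^sub>R \<mu> p \<and>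
        D' \<mu> p = M p *\<^sub>R \<gamma> p - A p *\<^sub>R \<nu>1 p - B p *\<^sub>R \<nu>2 p)"

definition hyp_gen_framed_surface_with ::
  "plane set \<Rightarrow> (plane \<Rightarrow> vec4) \<Rightarrow> (plane \<Rightarrow> vec4) \<Rightarrow> (plane \<Rightarrow> vec4) \<Rightarrow>
   (plane \<Rightarrow> real) \<Rightarrow> (plane \<Rightarrow> real) \<Rightarrow> bool" where
  "hyp_gen_framed_surface_with U x \<nu>1 \<nu>2 \<alpha> \<beta> \<longleftrightarrow>
     smooth_map_H3_Delta5 U x \<nu>1 \<nu>2 \<and> smooth_on U \<alpha> \<and> smooth_on U \<beta> \<and>
     (\<forall>p\<in>U. lorentz (x p) (\<nu>1 p) = 0 \<and> lorentz (x p) (\<nu>2 p) = 0 \<and>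
            wedge (x p) (pd_u x p) (pd_v x p) = \<alpha> p *\<^sub>R \<nu>1 p + \<beta> p *\<^sub>R \<nu>2 p)"

definition hyp_gen_framed_surface ::
  "plane set \<Rightarrow> (plane \<Rightarrow> vec4) \<Rightarrow> (plane \<Rightarrow> vec4) \<Rightarrow> (plane \<Rightarrow> vec4) \<Rightarrow> bool" where
  "hyp_gen_framed_surface U x \<nu>1 \<nu>2 \<longleftrightarrow> (\<exists>\<alpha> \<beta>. hyp_gen_framed_surface_with U x \<nu>1 \<nu>2 \<alpha> \<beta>)"

text \<open>The basic invariants of one index: index 1 for \<open>D = pd_u\<close>, index 2 for \<open>D = pd_v\<close>.\<close>

definition basic_invariants ::
  "((plane \<Rightarrow> vec4) \<Rightarrow> plane \<Rightarrow> vec4) \<Rightarrow> plane set \<Rightarrow>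
   (plane \<Rightarrow> vec4) \<Rightarrow> (plane \<Rightarrow> vec4) \<Rightarrow> (plane \<Rightarrow> vec4) \<Rightarrow>
   (plane \<Rightarrow> real) \<Rightarrow> (plane \<Rightarrow> real) \<Rightarrow> (plane \<Rightarrow> real) \<Rightarrow>
   (plane \<Rightarrow> real) \<Rightarrow> (plane \<Rightarrow> real) \<Rightarrow> (plane \<Rightarrow> real) \<Rightarrow> bool" where
  "basic_invariants D U x \<nu>1 \<nu>2 a b c e f g \<longleftrightarrow>
     (\<forall>h\<in>{a, b, c, e, f, g}. smooth_on U h) \<and>
     (let \<nu>3 = wedge_field x \<nu>1 \<nu>2 in
      \<forall>p\<in>U.
        D x p = a p *\<^sub>R \<nu>1 p + b p *\<^sub>R \<nu>2 p + c p *\<^sub>R \<nu>3 p \<and>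
        D \<nu>1 p = a p *\<^sub>R x p + e p *\<^sub>R \<nu>2 p + f p *\<^sub>R \<nu>3 p \<and>
        D \<nu>2 p = b p *\<^sub>R x p - e p *\<^sub>R \<nu>1 p + g p *\<^sub>R \<nu>3 p \<and>
        D \<nu>3 p = c p *\<^sub>R x p - f p *\<^sub>R \<nu>1 p - g p *\<^sub>R \<nu>2 p)"

end

theory Submission
  imports Defs
begin

text \<open>
  Write \<open>\<mu> = \<gamma> \<and> \<nu>1 \<and> \<nu>2\<close>.  For a family with respect to the parameter of the derivative \<open>D\<close>, the
  curve velocity \<open>D \<gamma>\<close> is \<open>m \<mu>\<close>, while \<open>D' \<gamma> = P \<nu>1 + Q \<nu>2 + M \<mu>\<close>.  Since the product is
  multilinear and alternating, the \<open>M\<close>-term drops out and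
  \<open>\<gamma> \<and> D \<gamma> \<and> D' \<gamma> = m P (\<gamma> \<and> \<mu> \<and> \<nu>1) + m Q (\<gamma> \<and> \<mu> \<and> \<nu>2)\<close>.  The two remaining products are double
  products, and the Lorentzian analogue of the rule for \<open>a \<times> (b \<times> c)\<close> (\<open>wedge_wedge\<close>) evaluates
  them on the frame: \<open>\<gamma> \<and> \<mu> \<and> \<nu>1 = \<nu>2\<close> and \<open>\<gamma> \<and> \<mu> \<and> \<nu>2 = - \<nu>1\<close>.  So the product lies in the span of
  \<open>\<nu>1, \<nu>2\<close> with coefficients \<open>- m Q\<close> and \<open>m P\<close>.  Passing from families in \<open>u\<close> to families in \<open>v\<close>
  exchanges the last two factors of \<open>x \<and> x\<^sub>u \<and> x\<^sub>v\<close>, hence the opposite signs there.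

  Conversely, if the \<open>\<nu>1\<close>- and \<open>\<nu>2\<close>-coefficients of \<open>D x\<close> vanish, then \<open>D x\<close> is a multiple of
  \<open>x \<and> \<nu>1 \<and> \<nu>2\<close>, which is orthogonal to \<open>\<nu>1\<close> and \<open>\<nu>2\<close>; the conditions on a family are symmetric in
  \<open>\<nu>1\<close> and \<open>\<nu>2\<close>.

  The analytic part of the claim is that the coefficients are smooth, that is, that smooth functions
  on an open set are closed under products (\<open>Ck_on_mult\<close>).
\<close>

section \<open>Products of smooth functions on open sets\<close>

lemma eventually_slice_u:
  assumes "open U" and "p \<in> U"
  shows "eventually (\<lambda>t. (t, snd p) \<in> U) (nhds (fst p))"
proof -
  have "((\<lambda>t. (t, snd p)) \<longlongrightarrow> p) (nhds (fst p))"
    using tendsto_Pair[OF filterlim_ident tendsto_const, of "snd p" "fst p"] by simp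
  then show ?thesis
    using assms topological_tendstoD by blast
qed

lemma eventually_slice_v:
  assumes "open U" and "p \<in> U"
  shows "eventually (\<lambda>t. (fst p, t) \<in> U) (nhds (snd p))"
proof -
  have "((\<lambda>t. (fst p, t)) \<longlongrightarrow> p) (nhds (snd p))"
    using tendsto_Pair[OF tendsto_const filterlim_ident, of "fst p" "snd p"] by simp
  then show ?thesis
    using assms topological_tendstoD by blast
qed

text \<open>Openness makes the partial derivatives at a point of \<open>U\<close> depend only on the values on \<open>U\<close>.
  This is what lets sum and product rules valid only on \<open>U\<close> be used inside the recursion of \<open>Ck_on\<close>.\<close>

lemma pd_cong:
  assumes "open U" and "\<And>q. q \<in> U \<Longrightarrow> f q = g q" and "p \<in> U"
  shows "pd_u f p = pd_u g p" and "pd_v f p = pd_v g p"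
proof -
  have "eventually (\<lambda>t. f (t, snd p) = g (t, snd p)) (nhds (fst p))"
    using eventually_slice_u[OF assms(1,3)] by eventually_elim (rule assms(2))
  then show "pd_u f p = pd_u g p"
    unfolding pd_u_def by (intro vector_derivative_cong_eq) auto
  have "eventually (\<lambda>t. f (fst p, t) = g (fst p, t)) (nhds (snd p))"
    using eventually_slice_v[OF assms(1,3)] by eventually_elim (rule assms(2))
  then show "pd_v f p = pd_v g p"
    unfolding pd_v_def by (intro vector_derivative_cong_eq) auto
qed

lemma Ck_on_cong:
  assumes "open U" and "\<And>p. p \<in> U \<Longrightarrow> f p = g p"
  shows "Ck_on k U f \<longleftrightarrow> Ck_on k U g"
  using assms(2)
proof (induction k arbitrary: f g)
  case 0
  then show ?case by (simp cong: continuous_on_cong)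
next
  case (Suc k)
  have "f differentiable_on U \<longleftrightarrow> g differentiable_on U"
    using Suc.prems unfolding differentiable_on_def
    by (metis differentiable_transform_within zero_less_one)
  moreover have "Ck_on k U (pd_u f) \<longleftrightarrow> Ck_on k U (pd_u g)"
    by (rule Suc.IH) (rule pd_cong(1)[OF assms(1) Suc.prems])
  moreover have "Ck_on k U (pd_v f) \<longleftrightarrow> Ck_on k U (pd_v g)"
    by (rule Suc.IH) (rule pd_cong(2)[OF assms(1) Suc.prems])
  ultimately show ?case by simp
qed

lemma has_pd:
  assumes "open U" and "f differentiable_on U" and "p \<in> U"
  shows "((\<lambda>t. f (t, snd p)) has_vector_derivative pd_u f p) (at (fst p))"
    and "((\<lambda>t. f (fst p, t)) has_vector_derivative pd_v f p) (at (snd p))"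
proof -
  have f: "f differentiable (at p)"
    using assms by (simp add: differentiable_on_eq_differentiable_at)
  have "(\<lambda>t. f (t, snd p)) differentiable (at (fst p))"
    by (rule differentiable_compose[where g = "\<lambda>t. (t, snd p)"])
       (use f in \<open>auto intro!: differentiable_Pair\<close>)
  then show "((\<lambda>t. f (t, snd p)) has_vector_derivative pd_u f p) (at (fst p))"
    by (simp add: pd_u_def vector_derivative_works)
  have "(\<lambda>t. f (fst p, t)) differentiable (at (snd p))"
    by (rule differentiable_compose[where g = "\<lambda>t. (fst p, t)"])
       (use f in \<open>auto intro!: differentiable_Pair\<close>)
  then show "((\<lambda>t. f (fst p, t)) has_vector_derivative pd_v f p) (at (snd p))"
    by (simp add: pd_v_def vector_derivative_works)
qed

lemma pd_add:
  assumes "open U" and "f differentiable_on U" and "g differentiable_on U" and "p \<in> U"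
  shows "pd_u (\<lambda>q. f q + g q) p = pd_u f p + pd_u g p"
    and "pd_v (\<lambda>q. f q + g q) p = pd_v f p + pd_v g p"
  unfolding pd_u_def[of "\<lambda>q. f q + g q"] pd_v_def[of "\<lambda>q. f q + g q"]
  using has_vector_derivative_add[OF has_pd(1)[OF assms(1,2,4)] has_pd(1)[OF assms(1,3,4)]]
    has_vector_derivative_add[OF has_pd(2)[OF assms(1,2,4)] has_pd(2)[OF assms(1,3,4)]]
  by (simp_all add: vector_derivative_at)

lemma pd_mult:
  fixes f g :: "plane \<Rightarrow> 'a::real_normed_algebra"
  assumes "open U" and "f differentiable_on U" and "g differentiable_on U" and "p \<in> U"
  shows "pd_u (\<lambda>q. f q * g q) p = f p * pd_u g p + pd_u f p * g p"
    and "pd_v (\<lambda>q. f q * g q) p = f p * pd_v g p + pd_v f p * g p"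
  unfolding pd_u_def[of "\<lambda>q. f q * g q"] pd_v_def[of "\<lambda>q. f q * g q"]
  using has_vector_derivative_mult[OF has_pd(1)[OF assms(1,2,4)] has_pd(1)[OF assms(1,3,4)]]
    has_vector_derivative_mult[OF has_pd(2)[OF assms(1,2,4)] has_pd(2)[OF assms(1,3,4)]]
  by (simp_all add: vector_derivative_at)

text \<open>The only content is at the bottom of the recursion: differentiable functions are continuous.\<close>

lemma Ck_on_SucD: "Ck_on (Suc k) U f \<Longrightarrow> Ck_on k U f"
proof (induction k arbitrary: f)
  case 0
  then show ?case by (simp add: differentiable_imp_continuous_on)
next
  case (Suc k)
  from Suc.prems have "f differentiable_on U" "Ck_on (Suc k) U (pd_u f)" "Ck_on (Suc k) U (pd_v f)"
    by (simp_all only: Ck_on.simps(2)[of "Suc k"])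
  then show ?case
    by (simp only: Ck_on.simps(2)[of k U f] Suc.IH)
qed

lemma Ck_on_add:
  assumes "open U" and "Ck_on k U f" and "Ck_on k U g"
  shows "Ck_on k U (\<lambda>p. f p + g p)"
  using assms(2,3)
proof (induction k arbitrary: f g)
  case 0
  then show ?case by (simp add: continuous_on_add)
next
  case (Suc k)
  then have f: "f differentiable_on U" and g: "g differentiable_on U" by simp_all
  have "Ck_on k U (\<lambda>p. pd_u f p + pd_u g p)" "Ck_on k U (\<lambda>p. pd_v f p + pd_v g p)"
    using Suc by simp_all
  then show ?case
    using f g Ck_on_cong[OF assms(1) pd_add(1)[OF assms(1) f g]]
      Ck_on_cong[OF assms(1) pd_add(2)[OF assms(1) f g]]
    by simp
qed

text \<open>By the product rule the partial derivatives of \<open>f g\<close> are sums of products of a factor and a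
  derivative of the other; these are of class \<open>C\<^sup>k\<close> by induction, since the undifferentiated
  factor is so as well.\<close>

lemma Ck_on_mult:
  fixes f g :: "plane \<Rightarrow> 'a::real_normed_algebra"
  assumes "open U" and "Ck_on k U f" and "Ck_on k U g"
  shows "Ck_on k U (\<lambda>p. f p * g p)"
  using assms(2,3)
proof (induction k arbitrary: f g)
  case 0
  then show ?case by (simp add: continuous_on_mult)
next
  case (Suc k)
  then have f: "f differentiable_on U" and g: "g differentiable_on U" by simp_all
  have "Ck_on k U f" "Ck_on k U g"
    using Suc.prems[THEN Ck_on_SucD] .
  then have "Ck_on k U (\<lambda>p. f p * pd_u g p + pd_u f p * g p)"
      "Ck_on k U (\<lambda>p. f p * pd_v g p + pd_v f p * g p)"
    using Suc by (auto intro!: Ck_on_add[OF assms(1)])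
  then show ?case
    using f g Ck_on_cong[OF assms(1) pd_mult(1)[OF assms(1) f g]]
      Ck_on_cong[OF assms(1) pd_mult(2)[OF assms(1) f g]]
    by simp
qed

lemma pd_const: "pd_u (\<lambda>_. c) = (\<lambda>_. 0)" "pd_v (\<lambda>_. c) = (\<lambda>_. 0)"
  by (auto simp: pd_u_def pd_v_def)

lemma Ck_on_const: "Ck_on k U (\<lambda>_. c)"
  by (induction k arbitrary: c) (simp_all add: pd_const)

lemma smooth_on_mult:
  fixes f g :: "plane \<Rightarrow> 'a::real_normed_algebra"
  assumes "open U" and "smooth_on U f" and "smooth_on U g"
  shows "smooth_on U (\<lambda>p. f p * g p)"
  using assms unfolding smooth_on_def by (blast intro: Ck_on_mult)

lemma smooth_on_uminus:
  fixes f :: "plane \<Rightarrow> 'a::real_normed_algebra_1"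
  assumes "open U" and "smooth_on U f"
  shows "smooth_on U (\<lambda>p. - f p)"
  using smooth_on_mult[OF assms(1) _ assms(2), of "\<lambda>_. - 1"]
  by (simp add: smooth_on_def Ck_on_const)

section \<open>The triple vector product of Lorentz space\<close>

lemma det_4:
  "det (A::'a::comm_ring_1^4^4) =
    A$1$1 * (A$2$2 * (A$3$3 * A$4$4 - A$3$4 * A$4$3) - A$2$3 * (A$3$2 * A$4$4 - A$3$4 * A$4$2)
           + A$2$4 * (A$3$2 * A$4$3 - A$3$3 * A$4$2)) -
    A$1$2 * (A$2$1 * (A$3$3 * A$4$4 - A$3$4 * A$4$3) - A$2$3 * (A$3$1 * A$4$4 - A$3$4 * A$4$1)
           + A$2$4 * (A$3$1 * A$4$3 - A$3$3 * A$4$1)) +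
    A$1$3 * (A$2$1 * (A$3$2 * A$4$4 - A$3$4 * A$4$2) - A$2$2 * (A$3$1 * A$4$4 - A$3$4 * A$4$1)
           + A$2$4 * (A$3$1 * A$4$2 - A$3$2 * A$4$1)) -
    A$1$4 * (A$2$1 * (A$3$2 * A$4$3 - A$3$3 * A$4$2) - A$2$2 * (A$3$1 * A$4$3 - A$3$3 * A$4$1)
           + A$2$3 * (A$3$1 * A$4$2 - A$3$2 * A$4$1))"
proof -
  have f1234: "finite {2::4, 3, 4}" "1 \<notin> {2::4, 3, 4}"
    by auto
  have f234: "finite {3::4, 4}" "2 \<notin> {3::4, 4}"
    by auto
  have f34: "finite {4::4}" "3 \<notin> {4::4}"
    by auto
  show ?thesis
    unfolding det_def UNIV_4
    unfolding sum_over_permutations_insert[OF f1234]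
    unfolding sum_over_permutations_insert[OF f234]
    unfolding sum_over_permutations_insert[OF f34]
    unfolding permutes_sing
    by (simp add: sign_swap_id permutation_swap_id permutation_compose sign_compose sign_id
        swap_id_eq algebra_simps)
qed

definition minor3 :: "4 \<Rightarrow> 4 \<Rightarrow> 4 \<Rightarrow> vec4 \<Rightarrow> vec4 \<Rightarrow> vec4 \<Rightarrow> real" where
  "minor3 i j k x y z =
     x $ i * (y $ j * z $ k - y $ k * z $ j) - x $ j * (y $ i * z $ k - y $ k * z $ i)
     + x $ k * (y $ i * z $ j - y $ j * z $ i)"

text \<open>Up to the metric, the components of the product are the cofactors of the first row of the
  defining determinant.  Their signs alternate, and the timelike component is negated once more by
  the metric, which gives the sign pattern below.\<close>

lemma wedge_eq_minors:
  "wedge x y z =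
     vector [- minor3 2 3 4 x y z, - minor3 1 3 4 x y z, minor3 1 2 4 x y z, - minor3 1 2 3 x y z]"
  unfolding wedge_def
  by (rule the1_equality[OF wedge_exists_unique])
     (simp add: det_4 lorentz_def minor3_def vector_def algebra_simps)

lemma wedge_components:
  "wedge x y z $ 1 = - minor3 2 3 4 x y z" "wedge x y z $ 2 = - minor3 1 3 4 x y z"
  "wedge x y z $ 3 = minor3 1 2 4 x y z" "wedge x y z $ 4 = - minor3 1 2 3 x y z"
  by (simp_all add: wedge_eq_minors vector_def)

lemma lorentz_commute: "lorentz x y = lorentz y x"
  by (simp add: lorentz_def mult.commute)

lemma lorentz_scaleR_left: "lorentz (c *\<^sub>R x) y = c * lorentz x y"
  by (simp add: lorentz_def algebra_simps)

text \<open>Pairing the product with one of its factors gives a determinant with a repeated row.\<close>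

lemma lorentz_wedge_second: "lorentz (wedge x y z) y = 0"
  by (simp add: lorentz_def wedge_components minor3_def algebra_simps)

lemma lorentz_wedge_third: "lorentz (wedge x y z) z = 0"
  by (simp add: lorentz_def wedge_components minor3_def algebra_simps)

lemma wedge_swap: "wedge x z y = - wedge x y z"
  by (simp add: vec_eq_iff forall_4 wedge_components minor3_def algebra_simps)

text \<open>The \<open>r\<close>-term vanishes because \<open>y\<close> then occurs twice.\<close>

lemma wedge_scaleR_combination:
  "wedge x (m *\<^sub>R y) (p *\<^sub>R a + q *\<^sub>R b + r *\<^sub>R y) = (m * p) *\<^sub>R wedge x y a + (m * q) *\<^sub>R wedge x y b"
  by (simp add: vec_eq_iff forall_4 wedge_components minor3_def algebra_simps)

text \<open>The counterpart of \<open>a \<times> (y \<times> z) = (a \<bullet> z) y - (a \<bullet> y) z\<close>: the right-hand side is the formal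
  determinant with rows \<open>(\<langle>a, x\<rangle>, \<langle>a, y\<rangle>, \<langle>a, z\<rangle>)\<close>, \<open>(\<langle>b, x\<rangle>, \<langle>b, y\<rangle>, \<langle>b, z\<rangle>)\<close>, \<open>(x, y, z)\<close>, with the
  opposite sign.  On a frame it gives the multiplication table without a separate computation of
  \<open>\<langle>\<mu>, \<mu>\<rangle>\<close>.\<close>

lemma wedge_wedge:
  "wedge a (wedge x y z) b =
     (lorentz a z * lorentz b y - lorentz a y * lorentz b z) *\<^sub>R x
     + (lorentz a x * lorentz b z - lorentz a z * lorentz b x) *\<^sub>R y
     + (lorentz a y * lorentz b x - lorentz a x * lorentz b y) *\<^sub>R z"
  by (simp add: vec_eq_iff forall_4 wedge_components minor3_def lorentz_def algebra_simps)

lemma wedge_orthonormal_frame: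
  assumes "x \<in> H3" and "(n1, n2) \<in> Delta5" and "lorentz x n1 = 0" and "lorentz x n2 = 0"
  shows "wedge x (wedge x n1 n2) n1 = n2" and "wedge x (wedge x n1 n2) n2 = - n1"
  using assms by (auto simp: wedge_wedge H3_def Delta5_def S31_def lorentz_commute[of n2 n1]
      lorentz_commute[of n1 x] lorentz_commute[of n2 x])

section \<open>Framed curve families and generalized framed surfaces\<close>

text \<open>Stated for an arbitrary pair of operators \<open>D, D'\<close>, so that it serves families in \<open>u\<close> and in \<open>v\<close>
  alike.\<close>

lemma family_wedge_derivatives:
  assumes "hyp_framed_curve_family D U \<gamma> \<nu>1 \<nu>2"
    and "family_curvature D D' U \<gamma> \<nu>1 \<nu>2 m n a b M N A B P Q" and "p \<in> U"
  shows "wedge (\<gamma> p) (D \<gamma> p) (D' \<gamma> p) = (- m p * Q p) *\<^sub>R \<nu>1 p + (m p * P p) *\<^sub>R \<nu>2 p"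
proof -
  let ?\<mu> = "wedge (\<gamma> p) (\<nu>1 p) (\<nu>2 p)"
  have D: "D \<gamma> p = m p *\<^sub>R ?\<mu>" and D': "D' \<gamma> p = P p *\<^sub>R \<nu>1 p + Q p *\<^sub>R \<nu>2 p + M p *\<^sub>R ?\<mu>"
    using assms(2,3) unfolding family_curvature_def Let_def wedge_field_def by blast+
  have "wedge (\<gamma> p) ?\<mu> (\<nu>1 p) = \<nu>2 p" and "wedge (\<gamma> p) ?\<mu> (\<nu>2 p) = - \<nu>1 p"
    using assms(1,3) unfolding hyp_framed_curve_family_def smooth_map_H3_Delta5_def
    by (auto intro!: wedge_orthonormal_frame)
  then show ?thesis
    unfolding D D' wedge_scaleR_combination by simp
qed

text \<open>What is left of \<open>D x\<close> is its component along \<open>x \<and> \<nu>1 \<and> \<nu>2\<close>, which is orthogonal to both normals.\<close>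

lemma framed_curve_family_if_normal_part_zero:
  assumes "hyp_gen_framed_surface U x \<nu>1 \<nu>2"
    and "basic_invariants D U x \<nu>1 \<nu>2 a b c e f g" and "\<forall>p\<in>U. a p = 0 \<and> b p = 0"
  shows "hyp_framed_curve_family D U x \<nu>1 \<nu>2"
proof -
  have "D x p = c p *\<^sub>R wedge (x p) (\<nu>1 p) (\<nu>2 p)" if "p \<in> U" for p
    using assms(2,3) that by (simp add: basic_invariants_def wedge_field_def Let_def)
  then have "\<forall>p\<in>U. lorentz (D x p) (\<nu>1 p) = 0 \<and> lorentz (D x p) (\<nu>2 p) = 0"
    by (simp add: lorentz_scaleR_left lorentz_wedge_second lorentz_wedge_third)
  with assms(1) show ?thesis
    unfolding hyp_gen_framed_surface_def hyp_gen_framed_surface_with_def hyp_framed_curve_family_def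
    by blast
qed

lemma framed_curve_family_swap:
  assumes "hyp_framed_curve_family D U x \<nu>1 \<nu>2"
  shows "hyp_framed_curve_family D U x \<nu>2 \<nu>1"
  using assms
  by (auto simp: hyp_framed_curve_family_def smooth_map_H3_Delta5_def Delta5_def
      lorentz_commute[of "\<nu>2 _" "\<nu>1 _"])

theorem proposition3p7:
  fixes U :: "plane set"
  assumes "open U" and "simply_connected U"
  shows
    "(\<forall>\<gamma> \<nu>1 \<nu>2 m1 n1 a1 b1 M1 N1 A1 B1 P1 Q1.
        hyp_framed_curve_family pd_u U \<gamma> \<nu>1 \<nu>2 \<and>
        family_curvature pd_u pd_v U \<gamma> \<nu>1 \<nu>2 m1 n1 a1 b1 M1 N1 A1 B1 P1 Q1 \<longrightarrow>
        hyp_gen_framed_surface_with U \<gamma> \<nu>1 \<nu>2 (\<lambda>p. - m1 p * Q1 p) (\<lambda>p. m1 p * P1 p)) \<and>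
     (\<forall>\<gamma> \<nu>1 \<nu>2 m2 n2 a2 b2 M2 N2 A2 B2 P2 Q2.
        hyp_framed_curve_family pd_v U \<gamma> \<nu>1 \<nu>2 \<and>
        family_curvature pd_v pd_u U \<gamma> \<nu>1 \<nu>2 m2 n2 a2 b2 M2 N2 A2 B2 P2 Q2 \<longrightarrow>
        hyp_gen_framed_surface_with U \<gamma> \<nu>1 \<nu>2 (\<lambda>p. m2 p * Q2 p) (\<lambda>p. - m2 p * P2 p)) \<and>
     (\<forall>x \<nu>1 \<nu>2 a1 b1 c1 e1 f1 g1 a2 b2 c2 e2 f2 g2.
        hyp_gen_framed_surface U x \<nu>1 \<nu>2 \<and>
        basic_invariants pd_u U x \<nu>1 \<nu>2 a1 b1 c1 e1 f1 g1 \<and>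
        basic_invariants pd_v U x \<nu>1 \<nu>2 a2 b2 c2 e2 f2 g2 \<longrightarrow>
        ((\<forall>p\<in>U. a1 p = 0 \<and> b1 p = 0) \<longrightarrow>
           hyp_framed_curve_family pd_u U x \<nu>1 \<nu>2 \<and> hyp_framed_curve_family pd_u U x \<nu>2 \<nu>1) \<and>
        ((\<forall>p\<in>U. a2 p = 0 \<and> b2 p = 0) \<longrightarrow>
           hyp_framed_curve_family pd_v U x \<nu>1 \<nu>2 \<and> hyp_framed_curve_family pd_v U x \<nu>2 \<nu>1))"
proof (intro conjI allI impI; (elim conjE)?)
  fix \<gamma> \<nu>1 \<nu>2 m n a b M N A B P Q
  assume fam: "hyp_framed_curve_family pd_u U \<gamma> \<nu>1 \<nu>2"
    and curv: "family_curvature pd_u pd_v U \<gamma> \<nu>1 \<nu>2 m n a b M N A B P Q"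
  have "smooth_on U m" "smooth_on U P" "smooth_on U Q"
    using curv by (simp_all add: family_curvature_def)
  then have "smooth_on U (\<lambda>p. - m p * Q p)" "smooth_on U (\<lambda>p. m p * P p)"
    using assms(1) by (auto intro: smooth_on_mult smooth_on_uminus)
  with fam family_wedge_derivatives[OF fam curv]
  show "hyp_gen_framed_surface_with U \<gamma> \<nu>1 \<nu>2 (\<lambda>p. - m p * Q p) (\<lambda>p. m p * P p)"
    by (simp add: hyp_gen_framed_surface_with_def hyp_framed_curve_family_def)
next
  fix \<gamma> \<nu>1 \<nu>2 m n a b M N A B P Q
  assume fam: "hyp_framed_curve_family pd_v U \<gamma> \<nu>1 \<nu>2"
    and curv: "family_curvature pd_v pd_u U \<gamma> \<nu>1 \<nu>2 m n a b M N A B P Q"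
  have "smooth_on U m" "smooth_on U P" "smooth_on U Q"
    using curv by (simp_all add: family_curvature_def)
  then have "smooth_on U (\<lambda>p. m p * Q p)" "smooth_on U (\<lambda>p. - m p * P p)"
    using assms(1) by (auto intro: smooth_on_mult smooth_on_uminus)
  moreover have "wedge (\<gamma> p) (pd_u \<gamma> p) (pd_v \<gamma> p) = (m p * Q p) *\<^sub>R \<nu>1 p + (- m p * P p) *\<^sub>R \<nu>2 p"
    if "p \<in> U" for p
    \<comment> \<open>Here \<open>D = pd_v\<close>, so the factors appear in the reverse order.\<close>
    using family_wedge_derivatives[OF fam curv that]
    by (simp add: wedge_swap[of "\<gamma> p" "pd_u \<gamma> p"])
  ultimately show "hyp_gen_framed_surface_with U \<gamma> \<nu>1 \<nu>2 (\<lambda>p. m p * Q p) (\<lambda>p. - m p * P p)"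
    using fam by (simp add: hyp_gen_framed_surface_with_def hyp_framed_curve_family_def)
qed (blast intro: framed_curve_family_if_normal_part_zero framed_curve_family_swap)+

end
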